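(* Let $0\to\mathfrak{h}_Q\xrightarrow{i}\mathfrak{e}_U\xrightarrow{p}\mathfrak{g}_P\to0$ be a split abelian extension of an averaging Lie algebra $\mathfrak{g}_P$ by a representation $\mathfrak{h}_Q$. Then as groups, $$\mathrm{Aut}_{\mathfrak{h}}(\mathfrak{e}_U)\cong C_\psi\ltimes\mathrm{Aut}_{\mathfrak{h}}^{\mathfrak{h},\mathfrak{g}}(\mathfrak{e}_U),$$ where the right-hand side is a semidirect product of groups (with $\mathrm{Aut}_{\mathfrak{h}}^{\mathfrak{h},\mathfrak{g}}(\mathfrak{e}_U)$ the normal factor).
   Context: Everything is over a field of characteristic zero. An averaging operator on a Lie algebra $\mathfrak{g}$ is a linear map $P:\mathfrak{g}\to\mathfrak{g}$ with $[P(x),P(y)]_{\mathfrak{g}}=P([P(x),y]_{\mathfrak{g}})$ for all $x,y$; an averaging Lie algebra $\mathfrak{g}_P$ is a Lie algebra $\mathfrak{g}$ with an averaging operator $P$. A morphism $\mathfrak{g}_P\to\mathfrak{g}'_{P'}$ is a Lie algebra homomorphism $\tau$ with $P'\circ\tau=\tau\circ P$; $\mathrm{Aut}(\mathfrak{g}_P)$ is the group of bijective morphisms $\mathfrak{g}_P\to\mathfrak{g}_P$. A representation $\mathfrak{h}_Q$ of $\mathfrak{g}_P$ is a Lie algebra representation $\psi:\mathfrak{g}\to\mathrm{End}(\mathfrak{h})$ on a vector space $\mathfrak{h}$ with a linear map $Q:\mathfrak{h}\to\mathfrak{h}$ such that $\psi_{P(x)}Q(h)=Q(\psi_{P(x)}h)=Q(\psi_xQ(h))$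 for all $x\in\mathfrak{g}$, $h\in\mathfrak{h}$. Given a representation $\mathfrak{h}_Q$, regard $\mathfrak{h}_Q$ as an averaging Lie algebra with the abelian (zero) bracket. An abelian extension of $\mathfrak{g}_P$ by the representation $\mathfrak{h}_Q$ is a short exact sequence of averaging Lie algebras $0\to\mathfrak{h}_Q\xrightarrow{i}\mathfrak{e}_U\xrightarrow{p}\mathfrak{g}_P\to0$ such that, for a linear section $s$ of $p$, the induced $\mathfrak{g}$-representation $x\mapsto(h\mapsto[s(x),h]_{\mathfrak{e}})$ on $\mathfrak{h}\cong i(\mathfrak{h})$ (independent of $s$) coincides with the given $\psi$. It is split if there is a section $s:\mathfrak{g}\to\mathfrak{e}$ of $p$ that is a morphism of averaging Lie algebras $\mathfrak{g}_P\to\mathfrak{e}_U$. $\mathrm{Aut}_{\mathfrak{h}}(\mathfrak{e}_U)$ is the group of $\gamma\in\mathrm{Aut}(\mathfrak{e}_U)$ with $\gamma(\mathfrak{h})=\mathfrak{h}$; $\Pi(\gamma)=(\gamma|_{\mathfrak{h}},p\gamma s)\in\mathrm{Aut}(\mathfrak{h}_Q)\times\mathrm{Aut}(\mathfrak{g}_P)$, where $p\gamma s$ is independent of the linear section $s$. $\mathrm{Aut}_{\mathfrak{h}}^{\mathfrak{h},\mathfrak{g}}(\mathfrak{e}_U)=\{\gamma\in\mathrm{Aut}_{\mathfrak{h}}(\mathfrak{e}_U):\Pi(\gamma)=(\mathrm{Id}_{\mathfrak{h}},\mathrm{Id}_{\mathfrak{g}})\}$. $C_\psi:=\{(\beta,\alpha)\in\mathrm{Aut}(\mathfrak{h}_Q)\times\mathrm{Aut}(\mathfrak{g}_P):\beta(\psi_xh)=\psi_{\alpha(x)}\beta(h)\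 \text{for all}\ x\in\mathfrak{g},h\in\mathfrak{h}\}$, a subgroup of $\mathrm{Aut}(\mathfrak{h}_Q)\times\mathrm{Aut}(\mathfrak{g}_P)$. *)

theory Defs
  imports Complex_Main "HOL-Algebra.Bij" "HOL-Algebra.Coset"
begin

text \<open>
  The underlying vector space of an algebra is a whole type of class
  \<^class>\<open>ab_group_add\<close>, together with its scalar multiplication; the ground field is a type of
  class \<^class>\<open>field_char_0\<close>.
\<close>

record ('k, 'a) avg_lie =
  scal :: "'k \<Rightarrow> 'a \<Rightarrow> 'a"
  brack :: "'a \<Rightarrow> 'a \<Rightarrow> 'a"
  avg :: "'a \<Rightarrow> 'a"

definition lie_bracket :: "('k::field_char_0 \<Rightarrow> 'a::ab_group_add \<Rightarrow> 'a) \<Rightarrow> ('a \<Rightarrow> 'a \<Rightarrow> 'a) \<Rightarrow> bool"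
  where "lie_bracket s b \<longleftrightarrow>
    (\<forall>x. Vector_Spaces.linear s s (b x)) \<and>
    (\<forall>y. Vector_Spaces.linear s s (\<lambda>x. b x y)) \<and>
    (\<forall>x. b x x = 0) \<and>
    (\<forall>x y z. b x (b y z) + b y (b z x) + b z (b x y) = 0)"

definition averaging_operator ::
  "('k::field_char_0 \<Rightarrow> 'a::ab_group_add \<Rightarrow> 'a) \<Rightarrow> ('a \<Rightarrow> 'a \<Rightarrow> 'a) \<Rightarrow> ('a \<Rightarrow> 'a) \<Rightarrow> bool"
  where "averaging_operator s b P \<longleftrightarrow>
    Vector_Spaces.linear s s P \<and> (\<forall>x y. b (P x) (P y) = P (b (P x) y))"

definition averaging_lie_algebra :: "('k::field_char_0, 'a::ab_group_add) avg_lie \<Rightarrow> bool"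
  where "averaging_lie_algebra G \<longleftrightarrow>
    vector_space (scal G) \<and> lie_bracket (scal G) (brack G) \<and>
    averaging_operator (scal G) (brack G) (avg G)"

definition avg_lie_hom ::
  "('k::field_char_0, 'a::ab_group_add) avg_lie \<Rightarrow> ('k, 'b::ab_group_add) avg_lie \<Rightarrow> ('a \<Rightarrow> 'b) set"
  where "avg_lie_hom G G' = {t. Vector_Spaces.linear (scal G) (scal G') t \<and>
    (\<forall>x y. t (brack G x y) = brack G' (t x) (t y)) \<and>
    avg G' \<circ> t = t \<circ> avg G}"

definition Aut :: "('k::field_char_0, 'a::ab_group_add) avg_lie \<Rightarrow> ('a \<Rightarrow> 'a) monoid"
  where "Aut G = \<lparr>carrier = {t \<in> avg_lie_hom G G. bij t}, mult = (\<circ>), one = id\<rparr>"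

definition lie_representation ::
  "('k::field_char_0, 'g::ab_group_add) avg_lie \<Rightarrow> ('k \<Rightarrow> 'h::ab_group_add \<Rightarrow> 'h)
    \<Rightarrow> ('g \<Rightarrow> 'h \<Rightarrow> 'h) \<Rightarrow> bool"
  where "lie_representation G s \<psi> \<longleftrightarrow>
    (\<forall>x. Vector_Spaces.linear s s (\<psi> x)) \<and>
    (\<forall>h. Vector_Spaces.linear (scal G) s (\<lambda>x. \<psi> x h)) \<and>
    (\<forall>x y h. \<psi> (brack G x y) h = \<psi> x (\<psi> y h) - \<psi> y (\<psi> x h))"

definition averaging_representation ::
  "('k::field_char_0, 'g::ab_group_add) avg_lie \<Rightarrow> ('k \<Rightarrow> 'h::ab_group_add \<Rightarrow> 'h)
    \<Rightarrow> ('g \<Rightarrow> 'h \<Rightarrow> 'h) \<Rightarrow> ('h \<Rightarrow> 'h) \<Rightarrow> bool"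
  where "averaging_representation G s \<psi> Q \<longleftrightarrow>
    vector_space s \<and> lie_representation G s \<psi> \<and> Vector_Spaces.linear s s Q \<and>
    (\<forall>x h. \<psi> (avg G x) (Q h) = Q (\<psi> (avg G x) h) \<and>
           Q (\<psi> (avg G x) h) = Q (\<psi> x (Q h)))"

definition abelian_avg_lie ::
  "('k::field_char_0 \<Rightarrow> 'h::ab_group_add \<Rightarrow> 'h) \<Rightarrow> ('h \<Rightarrow> 'h) \<Rightarrow> ('k, 'h) avg_lie"
  where "abelian_avg_lie s Q = \<lparr>scal = s, brack = (\<lambda>_ _. 0), avg = Q\<rparr>"

definition short_exact ::
  "('k::field_char_0, 'h::ab_group_add) avg_lie \<Rightarrow> ('k, 'e::ab_group_add) avg_lie
    \<Rightarrow> ('k, 'g::ab_group_add) avg_lie \<Rightarrow> ('h \<Rightarrow> 'e) \<Rightarrow> ('e \<Rightarrow> 'g) \<Rightarrow> bool"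
  where "short_exact H E G i p \<longleftrightarrow>
    averaging_lie_algebra H \<and> averaging_lie_algebra E \<and> averaging_lie_algebra G \<and>
    i \<in> avg_lie_hom H E \<and> p \<in> avg_lie_hom E G \<and>
    inj i \<and> range i = {e. p e = 0} \<and> surj p"

definition linear_section ::
  "('k::field_char_0, 'e::ab_group_add) avg_lie \<Rightarrow> ('k, 'g::ab_group_add) avg_lie
    \<Rightarrow> ('e \<Rightarrow> 'g) \<Rightarrow> ('g \<Rightarrow> 'e) \<Rightarrow> bool"
  where "linear_section E G p s \<longleftrightarrow> Vector_Spaces.linear (scal G) (scal E) s \<and> p \<circ> s = id"

text \<open>
  \<open>i\<close> is injective, so the last clause says that \<open>[s x, h]\<close> is \<open>\<psi>\<^sub>x h\<close> under the identification of
  \<open>\<hh>\<close> with \<open>i(\<hh>)\<close>. Linear sections exist and the clause does not depend on the choice of one,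
  see \<open>linear_section_ex\<close> and \<open>abelian_extension_section\<close> below.
\<close>

definition abelian_extension ::
  "('k::field_char_0, 'g::ab_group_add) avg_lie \<Rightarrow> ('k \<Rightarrow> 'h::ab_group_add \<Rightarrow> 'h)
    \<Rightarrow> ('g \<Rightarrow> 'h \<Rightarrow> 'h) \<Rightarrow> ('h \<Rightarrow> 'h) \<Rightarrow> ('k, 'e::ab_group_add) avg_lie
    \<Rightarrow> ('h \<Rightarrow> 'e) \<Rightarrow> ('e \<Rightarrow> 'g) \<Rightarrow> bool"
  where "abelian_extension G sh \<psi> Q E i p \<longleftrightarrow>
    short_exact (abelian_avg_lie sh Q) E G i p \<and>
    (\<exists>s. linear_section E G p s \<and> (\<forall>x h. brack E (s x) (i h) = i (\<psi> x h)))"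

definition split_extension ::
  "('k::field_char_0, 'e::ab_group_add) avg_lie \<Rightarrow> ('k, 'g::ab_group_add) avg_lie
    \<Rightarrow> ('e \<Rightarrow> 'g) \<Rightarrow> bool"
  where "split_extension E G p \<longleftrightarrow> (\<exists>s. s \<in> avg_lie_hom G E \<and> p \<circ> s = id)"

definition Aut_stab ::
  "('k::field_char_0, 'e::ab_group_add) avg_lie \<Rightarrow> ('h \<Rightarrow> 'e) \<Rightarrow> ('e \<Rightarrow> 'e) monoid"
  where "Aut_stab E i = (Aut E)\<lparr>carrier := {\<gamma> \<in> carrier (Aut E). \<gamma> ` range i = range i}\<rparr>"

text \<open>
  The restriction of \<open>\<gamma>\<close> to \<open>\<hh>\<close> is transported along \<open>i\<close>. The linear section is chosen
  arbitrarily; \<open>Pi_map_section\<close> shows that the result is the same for every one.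
\<close>

definition Pi_map ::
  "('k::field_char_0, 'e::ab_group_add) avg_lie \<Rightarrow> ('k, 'g::ab_group_add) avg_lie
    \<Rightarrow> ('h \<Rightarrow> 'e) \<Rightarrow> ('e \<Rightarrow> 'g) \<Rightarrow> ('e \<Rightarrow> 'e) \<Rightarrow> ('h \<Rightarrow> 'h) \<times> ('g \<Rightarrow> 'g)"
  where "Pi_map E G i p \<gamma> =
    (inv_into UNIV i \<circ> \<gamma> \<circ> i, p \<circ> \<gamma> \<circ> (SOME s. linear_section E G p s))"

definition Aut_stab_id ::
  "('k::field_char_0, 'e::ab_group_add) avg_lie \<Rightarrow> ('k, 'g::ab_group_add) avg_lie
    \<Rightarrow> ('h \<Rightarrow> 'e) \<Rightarrow> ('e \<Rightarrow> 'g) \<Rightarrow> ('e \<Rightarrow> 'e) monoid"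
  where "Aut_stab_id E G i p =
    (Aut_stab E i)\<lparr>carrier := {\<gamma> \<in> carrier (Aut_stab E i). Pi_map E G i p \<gamma> = (id, id)}\<rparr>"

definition C_group ::
  "('k::field_char_0, 'g::ab_group_add) avg_lie \<Rightarrow> ('k \<Rightarrow> 'h::ab_group_add \<Rightarrow> 'h)
    \<Rightarrow> ('g \<Rightarrow> 'h \<Rightarrow> 'h) \<Rightarrow> ('h \<Rightarrow> 'h) \<Rightarrow> (('h \<Rightarrow> 'h) \<times> ('g \<Rightarrow> 'g)) monoid"
  where "C_group G sh \<psi> Q =
    (Aut (abelian_avg_lie sh Q) \<times>\<times> Aut G)\<lparr>carrier :=
      {(\<beta>, \<alpha>). (\<beta>, \<alpha>) \<in> carrier (Aut (abelian_avg_lie sh Q) \<times>\<times> Aut G) \<and>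
        (\<forall>x h. \<beta> (\<psi> x h) = \<psi> (\<alpha> x) (\<beta> h))}\<rparr>"

text \<open>
  External semidirect product with normal factor \<open>N\<close>, for an action \<open>\<phi>\<close> of \<open>C\<close> on \<open>N\<close>
  (a homomorphism from \<open>C\<close> to \<^term>\<open>AutoGroup N\<close>); the pair \<open>(c, n)\<close> stands for the
  product \<open>n c\<close>, so that \<open>c n c\<^sup>-\<^sup>1 = \<phi> c n\<close>.
\<close>

definition semidirect_product ::
  "('c, 'm) monoid_scheme \<Rightarrow> ('n, 'l) monoid_scheme \<Rightarrow> ('c \<Rightarrow> 'n \<Rightarrow> 'n) \<Rightarrow> ('c \<times> 'n) monoid"
  where "semidirect_product C N \<phi> =
    \<lparr>carrier = carrier C \<times> carrier N,
     mult = (\<lambda>(c, n) (c', n'). (c \<otimes>\<^bsub>C\<^esub> c', n \<otimes>\<^bsub>N\<^esub> \<phi> c n')),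
     one = (\<one>\<^bsub>C\<^esub>, \<one>\<^bsub>N\<^esub>)\<rparr>"


section \<open>The notions are well-defined\<close>

lemma AutoGroup_hom_facts:
  assumes "group C" "group N" "\<phi> \<in> hom C (AutoGroup N)"
  shows "\<And>c n. c \<in> carrier C \<Longrightarrow> n \<in> carrier N \<Longrightarrow> \<phi> c n \<in> carrier N"
    and "\<And>c n n'. c \<in> carrier C \<Longrightarrow> n \<in> carrier N \<Longrightarrow> n' \<in> carrier N
      \<Longrightarrow> \<phi> c (n \<otimes>\<^bsub>N\<^esub> n') = \<phi> c n \<otimes>\<^bsub>N\<^esub> \<phi> c n'"
    and "\<And>c c' n. c \<in> carrier C \<Longrightarrow> c' \<in> carrier C \<Longrightarrow> n \<in> carrier N
      \<Longrightarrow> \<phi> (c \<otimes>\<^bsub>C\<^esub> c') n = \<phi> c (\<phi> c' n)"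
    and "\<And>n. n \<in> carrier N \<Longrightarrow> \<phi> \<one>\<^bsub>C\<^esub> n = n"
proof -
  have a: "\<phi> c \<in> auto N" if "c \<in> carrier C" for c
    using assms(3) that by (auto simp: hom_def AutoGroup_def)
  have h: "\<phi> c \<in> hom N N" and b: "\<phi> c \<in> Bij (carrier N)" if "c \<in> carrier C" for c
    using a[OF that] by (auto simp: auto_def)
  show "\<phi> c n \<in> carrier N" if "c \<in> carrier C" "n \<in> carrier N" for c n
    using h that by (auto simp: hom_def)
  show "\<phi> c (n \<otimes>\<^bsub>N\<^esub> n') = \<phi> c n \<otimes>\<^bsub>N\<^esub> \<phi> c n'"
    if "c \<in> carrier C" "n \<in> carrier N" "n' \<in> carrier N" for c n n'
    using h that by (auto simp: hom_def)
  have "\<phi> (c \<otimes>\<^bsub>C\<^esub> c') = \<phi> c \<otimes>\<^bsub>AutoGroup N\<^esub> \<phi> c'"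
    if "c \<in> carrier C" "c' \<in> carrier C" for c c'
    using assms(3) that by (auto simp: hom_def)
  then show "\<phi> (c \<otimes>\<^bsub>C\<^esub> c') n = \<phi> c (\<phi> c' n)"
    if "c \<in> carrier C" "c' \<in> carrier C" "n \<in> carrier N" for c c' n
    using b that by (simp add: AutoGroup_def BijGroup_def compose_def)
  show "\<phi> \<one>\<^bsub>C\<^esub> n = n" if "n \<in> carrier N" for n
    using hom_one[OF assms(3) assms(1) group.AutoGroup[OF assms(2)]] that
    by (simp add: AutoGroup_def BijGroup_def)
qed

lemma group_semidirect_product:
  assumes "group C" "group N" "\<phi> \<in> hom C (AutoGroup N)"
  shows "group (semidirect_product C N \<phi>)"
proof -
  interpret C: group C by fact
  interpret N: group N by fact
  note f = AutoGroup_hom_facts[OF assms]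
  show ?thesis
  proof (rule groupI)
    fix x assume x: "x \<in> carrier (semidirect_product C N \<phi>)"
    obtain c n where xe: "x = (c, n)" by force
    with x have c: "c \<in> carrier C" and n: "n \<in> carrier N"
      by (auto simp: semidirect_product_def)
    have "\<phi> (inv\<^bsub>C\<^esub> c) (inv\<^bsub>N\<^esub> n) \<otimes>\<^bsub>N\<^esub> \<phi> (inv\<^bsub>C\<^esub> c) n = \<phi> (inv\<^bsub>C\<^esub> c) \<one>\<^bsub>N\<^esub>"
      using c n by (simp flip: f(2))
    also have "\<dots> = \<one>\<^bsub>N\<^esub>"
      using f(1,2)[of "inv\<^bsub>C\<^esub> c" "\<one>\<^bsub>N\<^esub>"] f(2)[of "inv\<^bsub>C\<^esub> c" "\<one>\<^bsub>N\<^esub>" "\<one>\<^bsub>N\<^esub>"] c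
      by (metis C.inv_closed N.l_cancel_one' N.one_closed N.r_one)
    finally show "\<exists>y\<in>carrier (semidirect_product C N \<phi>).
        y \<otimes>\<^bsub>semidirect_product C N \<phi>\<^esub> x = \<one>\<^bsub>semidirect_product C N \<phi>\<^esub>"
      using c n xe f(1)
      by (intro bexI[of _ "(inv\<^bsub>C\<^esub> c, \<phi> (inv\<^bsub>C\<^esub> c) (inv\<^bsub>N\<^esub> n))"])
        (auto simp: semidirect_product_def)
  qed (auto simp: semidirect_product_def f C.m_assoc N.m_assoc)
qed

lemma linear_facts:
  assumes "Vector_Spaces.linear s1 s2 f"
  shows "f (x + y) = f x + f y" "f (x - y) = f x - f y" "f 0 = 0" "f (s1 r x) = s2 r (f x)"
proof -
  interpret Vector_Spaces.linear s1 s2 f by fact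
  show "f (x + y) = f x + f y" "f (x - y) = f x - f y" "f 0 = 0" "f (s1 r x) = s2 r (f x)"
    by (simp_all add: add diff zero scale)
qed

lemma linear_inv:
  assumes "Vector_Spaces.linear s1 s2 f" "bij f"
  shows "Vector_Spaces.linear s2 s1 (inv_into UNIV f)"
proof -
  interpret Vector_Spaces.linear s1 s2 f by fact
  note i = bij_inv_eq_iff[OF assms(2)] surj_f_inv_f[OF bij_is_surj[OF assms(2)]]
  have "module_hom s2 s1 (inv_into UNIV f)"
    using i by unfold_locales (metis add, metis scale)
  then show ?thesis
    by (simp add: linear_iff_module_hom)
qed

lemma group_Aut:
  assumes "averaging_lie_algebra G"
  shows "group (Aut G)"
proof (rule groupI)
  have v: "vector_space (scal G)"
    using assms by (simp add: averaging_lie_algebra_def)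
  then show "\<one>\<^bsub>Aut G\<^esub> \<in> carrier (Aut G)"
    by (auto simp: Aut_def avg_lie_hom_def vector_space.linear_id)
  fix x y assume xy: "x \<in> carrier (Aut G)" "y \<in> carrier (Aut G)"
  then show "x \<otimes>\<^bsub>Aut G\<^esub> y \<in> carrier (Aut G)"
    by (auto simp: Aut_def avg_lie_hom_def fun_eq_iff intro: Vector_Spaces.linear_compose bij_comp)
next
  fix x assume "x \<in> carrier (Aut G)"
  then have b: "bij x" and l: "Vector_Spaces.linear (scal G) (scal G) x"
    and br: "\<And>a b. x (brack G a b) = brack G (x a) (x b)" and av: "\<And>a. avg G (x a) = x (avg G a)"
    by (auto simp: Aut_def avg_lie_hom_def fun_eq_iff)
  note i = bij_inv_eq_iff[OF b] surj_f_inv_f[OF bij_is_surj[OF b]]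
  have "inv_into UNIV x (brack G u w) = brack G (inv_into UNIV x u) (inv_into UNIV x w)" for u w
    using i br by metis
  moreover have "avg G (inv_into UNIV x u) = inv_into UNIV x (avg G u)" for u
    using i av by metis
  ultimately have "inv_into UNIV x \<in> carrier (Aut G)"
    using linear_inv[OF l b] bij_imp_bij_inv[OF b]
    by (auto simp: Aut_def avg_lie_hom_def fun_eq_iff)
  then show "\<exists>y\<in>carrier (Aut G). y \<otimes>\<^bsub>Aut G\<^esub> x = \<one>\<^bsub>Aut G\<^esub>"
    using b by (intro bexI[of _ "inv_into UNIV x"]) (auto simp: Aut_def bij_def)
qed (auto simp: Aut_def)

lemma inv_Aut:
  assumes "averaging_lie_algebra G" "x \<in> carrier (Aut G)"
  shows "bij x" "inv\<^bsub>Aut G\<^esub> x = inv_into UNIV x"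
proof -
  interpret group "Aut G" using assms(1) by (rule group_Aut)
  show b: "bij x"
    using assms(2) by (simp add: Aut_def)
  have "inv\<^bsub>Aut G\<^esub> x \<circ> x = id"
    using l_inv[OF assms(2)] by (simp add: Aut_def)
  then show "inv\<^bsub>Aut G\<^esub> x = inv_into UNIV x"
    by (metis b bij_is_surj comp_id fun.map_comp id_comp surj_iff)
qed

lemma subgroup_Aut_stab:
  assumes "averaging_lie_algebra E"
  shows "subgroup (carrier (Aut_stab E i)) (Aut E)"
proof -
  interpret group "Aut E" using assms by (rule group_Aut)
  show ?thesis
  proof (rule subgroupI)
    have "id \<in> carrier (Aut E)"
      using one_closed by (simp add: Aut_def)
    then show "carrier (Aut_stab E i) \<noteq> {}"
      by (auto simp: Aut_stab_def)
    fix a assume a: "a \<in> carrier (Aut_stab E i)"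
    then have a': "a \<in> carrier (Aut E)" "a ` range i = range i"
      by (auto simp: Aut_stab_def)
    have "inv_into UNIV a ` range i = range i"
      using a'(2) inv_Aut(1)[OF assms a'(1)] by (metis bij_is_inj image_inv_f_f)
    then show "inv\<^bsub>Aut E\<^esub> a \<in> carrier (Aut_stab E i)"
      using inv_closed[OF a'(1)] inv_Aut(2)[OF assms a'(1)] by (auto simp: Aut_stab_def)
    fix b assume b: "b \<in> carrier (Aut_stab E i)"
    have "a \<otimes>\<^bsub>Aut E\<^esub> b \<in> carrier (Aut E)"
      using a b by (auto simp: Aut_stab_def)
    moreover have "(a \<circ> b) ` range i = range i"
      using a b unfolding Aut_stab_def image_comp[symmetric] by simp
    ultimately show "a \<otimes>\<^bsub>Aut E\<^esub> b \<in> carrier (Aut_stab E i)"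
      by (simp add: Aut_stab_def Aut_def)
  qed (auto simp: Aut_stab_def)
qed

lemma group_Aut_stab:
  assumes "averaging_lie_algebra E"
  shows "group (Aut_stab E i)"
  using group.subgroup_imp_group[OF group_Aut[OF assms] subgroup_Aut_stab[OF assms]]
  by (simp add: Aut_stab_def)

lemma subgroup_C_group:
  assumes "averaging_lie_algebra G" "averaging_lie_algebra (abelian_avg_lie sh Q)"
  shows "subgroup (carrier (C_group G sh \<psi> Q)) (Aut (abelian_avg_lie sh Q) \<times>\<times> Aut G)"
proof -
  let ?H = "abelian_avg_lie sh Q"
  interpret group "Aut ?H \<times>\<times> Aut G"
    using assms by (intro DirProd_group group_Aut)
  show ?thesis
  proof (rule subgroupI)
    have "(id, id) \<in> carrier (Aut ?H \<times>\<times> Aut G)"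
      using one_closed by (simp add: Aut_def DirProd_def)
    then have "(id, id) \<in> carrier (C_group G sh \<psi> Q)"
      by (simp add: C_group_def)
    then show "carrier (C_group G sh \<psi> Q) \<noteq> {}"
      by blast
    fix a assume a: "a \<in> carrier (C_group G sh \<psi> Q)"
    obtain b0 a0 where ae: "a = (b0, a0)" by force
    have m: "b0 \<in> carrier (Aut ?H)" "a0 \<in> carrier (Aut G)"
      and e: "b0 (\<psi> x h) = \<psi> (a0 x) (b0 h)" for x h
      using a ae by (auto simp: C_group_def DirProd_def)
    note iv = inv_Aut[OF assms(2) m(1)] inv_Aut[OF assms(1) m(2)]
    note i = bij_inv_eq_iff[OF iv(1)] surj_f_inv_f[OF bij_is_surj[OF iv(1)]]
      surj_f_inv_f[OF bij_is_surj[OF iv(3)]]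
    have "inv_into UNIV b0 (\<psi> x h) = \<psi> (inv_into UNIV a0 x) (inv_into UNIV b0 h)" for x h
      using i e by metis
    moreover have "inv\<^bsub>Aut ?H \<times>\<times> Aut G\<^esub> a = (inv_into UNIV b0, inv_into UNIV a0)"
      using iv m assms by (simp add: ae inv_DirProd group_Aut)
    moreover have "inv\<^bsub>Aut ?H \<times>\<times> Aut G\<^esub> a \<in> carrier (Aut ?H \<times>\<times> Aut G)"
      using m ae by (intro inv_closed) (auto simp: DirProd_def)
    ultimately show "inv\<^bsub>Aut ?H \<times>\<times> Aut G\<^esub> a \<in> carrier (C_group G sh \<psi> Q)"
      by (auto simp: C_group_def)
    fix c assume c: "c \<in> carrier (C_group G sh \<psi> Q)"
    have "a \<otimes>\<^bsub>Aut ?H \<times>\<times> Aut G\<^esub> c \<in> carrier (Aut ?H \<times>\<times> Aut G)"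
      using a c by (intro m_closed) (auto simp: C_group_def)
    then show "a \<otimes>\<^bsub>Aut ?H \<times>\<times> Aut G\<^esub> c \<in> carrier (C_group G sh \<psi> Q)"
      using a c by (auto simp: C_group_def DirProd_def Aut_def)
  qed (auto simp: C_group_def)
qed

lemma averaging_lie_algebra_abelian:
  assumes "averaging_representation G sh \<psi> Q"
  shows "averaging_lie_algebra (abelian_avg_lie sh Q)"
proof -
  have v: "vector_space sh"
    using assms by (simp add: averaging_representation_def)
  have Q: "Vector_Spaces.linear sh sh Q"
    using assms by (simp add: averaging_representation_def)
  interpret vector_space_pair sh sh
    using v by (simp add: vector_space_pair_def)
  show ?thesis
    using v Q linear_facts(3)[OF Q] linear_zero
    by (simp add: averaging_lie_algebra_def abelian_avg_lie_def lie_bracket_def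
        averaging_operator_def)
qed

lemma group_C_group:
  assumes "averaging_lie_algebra G" "averaging_representation G sh \<psi> Q"
  shows "group (C_group G sh \<psi> Q)"
proof -
  have H: "averaging_lie_algebra (abelian_avg_lie sh Q)"
    using assms(2) by (rule averaging_lie_algebra_abelian)
  show ?thesis
    using group.subgroup_imp_group[OF DirProd_group[OF group_Aut[OF H] group_Aut[OF assms(1)]]
        subgroup_C_group[OF assms(1) H]]
    by (simp add: C_group_def)
qed

lemma linear_section_ex:
  assumes "short_exact H E G i p"
  shows "\<exists>s. linear_section E G p s"
proof -
  have v: "vector_space (scal E)" "vector_space (scal G)"
    and l: "Vector_Spaces.linear (scal E) (scal G) p" "surj p"
    using assms by (auto simp: short_exact_def averaging_lie_algebra_def avg_lie_hom_def)
  interpret vector_space_pair "scal E" "scal G"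
    using v by (simp add: vector_space_pair_def)
  show ?thesis
    using linear_surjective_right_inverse[OF l] by (auto simp: linear_section_def)
qed

lemma abelian_extension_section:
  assumes "abelian_extension G sh \<psi> Q E i p" "linear_section E G p s"
  shows "brack E (s x) (i h) = i (\<psi> x h)"
proof -
  let ?H = "abelian_avg_lie sh Q"
  obtain s' where s': "linear_section E G p s'" "\<And>x h. brack E (s' x) (i h) = i (\<psi> x h)"
    and se: "short_exact ?H E G i p"
    using assms(1) by (auto simp: abelian_extension_def)
  have p: "Vector_Spaces.linear (scal E) (scal G) p"
    and i: "Vector_Spaces.linear sh (scal E) i" "\<And>a b. i 0 = brack E (i a) (i b)"
    using se by (auto simp: short_exact_def avg_lie_hom_def abelian_avg_lie_def)
  have b: "Vector_Spaces.linear (scal E) (scal E) (\<lambda>u. brack E u (i h))"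
    using se by (auto simp: short_exact_def averaging_lie_algebra_def lie_bracket_def)
  have "p (s x - s' x) = 0"
    using assms(2) s'(1) by (simp add: linear_facts(2)[OF p] linear_section_def fun_eq_iff)
  then obtain h' where "s x - s' x = i h'"
    using se unfolding short_exact_def by blast
  then have "brack E (s x - s' x) (i h) = 0"
    using i linear_facts(3)[OF i(1)] by metis
  then show ?thesis
    using s'(2) by (simp add: linear_facts(2)[OF b])
qed

lemma Pi_map_section:
  assumes "short_exact H E G i p" "\<gamma> \<in> carrier (Aut_stab E i)" "linear_section E G p s"
  shows "Pi_map E G i p \<gamma> = (inv_into UNIV i \<circ> \<gamma> \<circ> i, p \<circ> \<gamma> \<circ> s)"
    and "i \<circ> (inv_into UNIV i \<circ> \<gamma> \<circ> i) = \<gamma> \<circ> i"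
    and "p \<circ> \<gamma> = (p \<circ> \<gamma> \<circ> s) \<circ> p"
proof -
  have p: "Vector_Spaces.linear (scal E) (scal G) p" and r: "range i = {e. p e = 0}"
    using assms(1) by (auto simp: short_exact_def avg_lie_hom_def)
  have g: "Vector_Spaces.linear (scal E) (scal E) \<gamma>" "\<gamma> ` range i = range i"
    using assms(2) by (auto simp: Aut_stab_def Aut_def avg_lie_hom_def)
  have *: "p (\<gamma> u) = p (\<gamma> w)" if "p u = p w" for u w
  proof -
    have "u - w \<in> range i"
      using that by (simp add: r linear_facts(2)[OF p])
    then have "\<gamma> (u - w) \<in> range i"
      using g(2) by blast
    then show ?thesis
      by (simp add: r linear_facts(2)[OF p] linear_facts(2)[OF g(1)])
  qed
  have "linear_section E G p (SOME s. linear_section E G p s)"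
    using someI[of "linear_section E G p", OF assms(3)] by simp
  then have "p (\<gamma> ((SOME s. linear_section E G p s) x)) = p (\<gamma> (s x))" for x
    using assms(3) by (intro *) (simp add: linear_section_def fun_eq_iff)
  then show "Pi_map E G i p \<gamma> = (inv_into UNIV i \<circ> \<gamma> \<circ> i, p \<circ> \<gamma> \<circ> s)"
    by (simp add: Pi_map_def fun_eq_iff)
  show "i \<circ> (inv_into UNIV i \<circ> \<gamma> \<circ> i) = \<gamma> \<circ> i"
  proof
    fix h
    have "\<gamma> (i h) \<in> range i"
      using g(2) by blast
    then show "(i \<circ> (inv_into UNIV i \<circ> \<gamma> \<circ> i)) h = (\<gamma> \<circ> i) h"
      by (simp add: f_inv_into_f)
  qed
  show "p \<circ> \<gamma> = (p \<circ> \<gamma> \<circ> s) \<circ> p"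
    using assms(3) by (auto simp: fun_eq_iff linear_section_def intro!: *)
qed

lemma Pi_map_comp:
  assumes "short_exact H E G i p" "\<gamma> \<in> carrier (Aut_stab E i)" "\<delta> \<in> carrier (Aut_stab E i)"
  shows "Pi_map E G i p (\<gamma> \<circ> \<delta>) =
    (fst (Pi_map E G i p \<gamma>) \<circ> fst (Pi_map E G i p \<delta>),
     snd (Pi_map E G i p \<gamma>) \<circ> snd (Pi_map E G i p \<delta>))"
proof -
  obtain s where s: "linear_section E G p s"
    using linear_section_ex[OF assms(1)] by blast
  interpret A: group "Aut_stab E i"
    using assms(1) by (intro group_Aut_stab) (simp add: short_exact_def)
  have gd: "\<gamma> \<circ> \<delta> \<in> carrier (Aut_stab E i)"
    using A.m_closed[OF assms(2,3)] by (simp add: Aut_stab_def Aut_def)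
  note f = Pi_map_section[OF assms(1,2) s] and f' = Pi_map_section[OF assms(1,3) s]
  have "inv_into UNIV i (\<gamma> (\<delta> (i h))) = inv_into UNIV i (\<gamma> (i (inv_into UNIV i (\<delta> (i h)))))" for h
    using f'(2) by (simp add: fun_eq_iff)
  moreover have "p (\<gamma> (\<delta> (s x))) = p (\<gamma> (s (p (\<delta> (s x)))))" for x
    using f(3) by (simp add: fun_eq_iff)
  ultimately show ?thesis
    unfolding f(1) f'(1) Pi_map_section(1)[OF assms(1) gd s] by (simp add: fun_eq_iff)
qed

lemma Aut_stab_id_normal:
  assumes "short_exact H E G i p"
  shows "carrier (Aut_stab_id E G i p) \<lhd> Aut_stab E i"
proof -
  interpret A: group "Aut_stab E i"
    using assms by (intro group_Aut_stab) (simp add: short_exact_def)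
  have c: "x \<otimes>\<^bsub>Aut_stab E i\<^esub> y = x \<circ> y" "\<one>\<^bsub>Aut_stab E i\<^esub> = id" for x y
    by (simp_all add: Aut_stab_def Aut_def)
  obtain s where s: "linear_section E G p s"
    using linear_section_ex[OF assms] by blast
  have "inj i"
    using assms by (simp add: short_exact_def)
  then have one: "Pi_map E G i p id = (id, id)"
    using Pi_map_section(1)[OF assms A.one_closed s] s
    by (simp add: c linear_section_def)
  have inv: "inv\<^bsub>Aut_stab E i\<^esub> x \<in> carrier (Aut_stab_id E G i p)"
    if "x \<in> carrier (Aut_stab_id E G i p)" for x
  proof -
    have x: "x \<in> carrier (Aut_stab E i)" "Pi_map E G i p x = (id, id)"
      using that by (auto simp: Aut_stab_id_def)
    have "Pi_map E G i p (inv\<^bsub>Aut_stab E i\<^esub> x \<circ> x) = (id, id)"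
      using A.l_inv[OF x(1)] one by (simp add: c)
    then show ?thesis
      using x Pi_map_comp[OF assms A.inv_closed[OF x(1)] x(1)]
      by (simp add: Aut_stab_id_def prod_eq_iff)
  qed
  have sub: "subgroup (carrier (Aut_stab_id E G i p)) (Aut_stab E i)"
  proof (rule A.subgroupI)
    show "carrier (Aut_stab_id E G i p) \<noteq> {}"
      using one A.one_closed by (auto simp: Aut_stab_id_def c)
    fix x y assume "x \<in> carrier (Aut_stab_id E G i p)" "y \<in> carrier (Aut_stab_id E G i p)"
    then show "x \<otimes>\<^bsub>Aut_stab E i\<^esub> y \<in> carrier (Aut_stab_id E G i p)"
      using A.m_closed[of x y] Pi_map_comp[OF assms, of x y] by (simp add: Aut_stab_id_def c)
  qed (auto simp: inv, auto simp: Aut_stab_id_def)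
  have "x \<otimes>\<^bsub>Aut_stab E i\<^esub> h \<otimes>\<^bsub>Aut_stab E i\<^esub> inv\<^bsub>Aut_stab E i\<^esub> x \<in> carrier (Aut_stab_id E G i p)"
    if x: "x \<in> carrier (Aut_stab E i)" and h: "h \<in> carrier (Aut_stab_id E G i p)" for x h
  proof -
    have h': "h \<in> carrier (Aut_stab E i)" "Pi_map E G i p h = (id, id)"
      using h by (auto simp: Aut_stab_id_def)
    have xh: "x \<circ> h \<in> carrier (Aut_stab E i)"
      using A.m_closed[OF x h'(1)] by (simp add: c)
    have "Pi_map E G i p (x \<circ> h \<circ> inv\<^bsub>Aut_stab E i\<^esub> x)
        = Pi_map E G i p (x \<circ> inv\<^bsub>Aut_stab E i\<^esub> x)"
      using Pi_map_comp[OF assms xh A.inv_closed[OF x]] Pi_map_comp[OF assms x h'(1)]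
        Pi_map_comp[OF assms x A.inv_closed[OF x]] h'(2) by simp
    also have "\<dots> = (id, id)"
      using A.r_inv[OF x] one by (simp add: c)
    finally show ?thesis
      using A.m_closed[OF A.m_closed[OF x h'(1)] A.inv_closed[OF x]]
      by (simp add: Aut_stab_id_def c)
  qed
  with sub show ?thesis
    by (simp add: A.normal_inv_iff)
qed

end

theory Submission
  imports Defs
begin

text \<open>
  Restriction to \<open>\<hh>\<close> and passage to the quotient turn the Lie-algebraic question into one about
  a sequence of groups, which is exact when the extension splits,
  \<open>1 \<rightarrow> Aut\<^sub>\<hh>\<^sup>\<hh>\<^sup>,\<^sup>\<gg>(E) \<rightarrow> Aut\<^sub>\<hh>(E) \<rightarrow> C\<^sub>\<psi> \<rightarrow> 1\<close>.
  The map \<open>\<Pi>\<close> takes values in \<open>C\<^sub>\<psi>\<close> because \<open>[e, i h] = i (\<psi>\<^bsub>p e\<^esub> h)\<close> for \<^emph>\<open>every\<close> \<open>e\<close> (the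
  kernel is abelian), so that applying an automorphism \<open>\<gamma>\<close> to this identity gives the compatibility
  of its two components (\<open>Pi_map_in_C_group\<close>). The kernel of \<open>\<Pi>\<close> is the normal factor
  by definition.

  If \<open>s\<close> splits the extension, then every \<open>e\<close> is uniquely \<open>i h + s x\<close>, and in these coordinates
  \<open>E\<close> is the semidirect product algebra: the bracket is
  \<open>[i h + s x, i k + s y] = i (\<psi>\<^sub>x k - \<psi>\<^sub>y h) + s [x, y]\<close> and the averaging operator acts as
  \<open>Q\<close> on \<open>h\<close> and \<open>P\<close> on \<open>x\<close>. Both formulas involve only the data that a pair
  \<open>(\<beta>, \<alpha>)\<close> of \<open>C\<^sub>\<psi>\<close> respects, so \<open>i h + s x \<mapsto> i (\<beta> h) + s (\<alpha> x)\<close> is an automorphism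
  (\<open>lift_in_Aut_stab\<close>). This lift is multiplicative and is a right inverse of \<open>\<Pi>\<close>, and a group
  epimorphism with such a right inverse exhibits its source as a semidirect product of
  its image and its kernel (\<open>split_epi_semidirect_product\<close>).
\<close>

section \<open>Split epimorphisms of groups\<close>

text \<open>
  The action is conjugation through the splitting \<open>t\<close>. The isomorphism goes from the semidirect
  product to \<open>A\<close> and sends \<open>(c, n)\<close> to \<open>n (t c)\<close>; an element \<open>a\<close> is hit by
  \<open>(\<pi> a, a (t (\<pi> a))\<^sup>-\<^sup>1)\<close>.
\<close>

lemma split_epi_semidirect_product:
  assumes "group A" "group C" and \<pi>: "\<pi> \<in> hom A C" and t: "t \<in> hom C A"
    and split: "\<And>c. c \<in> carrier C \<Longrightarrow> \<pi> (t c) = c"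
  defines "N \<equiv> A\<lparr>carrier := kernel A C \<pi>\<rparr>"
  shows "\<exists>\<phi> \<in> hom C (AutoGroup N). A \<cong> semidirect_product C N \<phi>"
proof -
  interpret A: group A by fact
  interpret C: group C by fact
  interpret P: group_hom A C \<pi> by unfold_locales (rule \<pi>)
  interpret T: group_hom C A t by unfold_locales (rule t)
  have N: "group N"
    unfolding N_def using P.subgroup_kernel by (rule A.subgroup_imp_group)
  interpret N: group N by (rule N)
  have ker: "n \<in> carrier N \<longleftrightarrow> n \<in> carrier A \<and> \<pi> n = \<one>\<^bsub>C\<^esub>" for n
    by (auto simp: N_def kernel_def)
  have NA: "x \<otimes>\<^bsub>N\<^esub> y = x \<otimes>\<^bsub>A\<^esub> y" "\<one>\<^bsub>N\<^esub> = \<one>\<^bsub>A\<^esub>" for x y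
    by (simp_all add: N_def)
  define \<phi> where "\<phi> c = (\<lambda>n\<in>carrier N. t c \<otimes>\<^bsub>A\<^esub> n \<otimes>\<^bsub>A\<^esub> inv\<^bsub>A\<^esub> (t c))" for c
  have cl: "\<phi> c n \<in> carrier N" if "c \<in> carrier C" "n \<in> carrier N" for c n
    using that by (simp add: \<phi>_def ker split)
  have \<phi>_comp: "\<phi> (c \<otimes>\<^bsub>C\<^esub> d) n = \<phi> c (\<phi> d n)"
    if "c \<in> carrier C" "d \<in> carrier C" "n \<in> carrier N" for c d n
    using that cl[OF that(2,3)] by (simp add: \<phi>_def ker A.m_assoc A.inv_mult_group)
  have \<phi>_one: "\<phi> \<one>\<^bsub>C\<^esub> n = n" if "n \<in> carrier N" for n
    using that by (simp add: \<phi>_def ker)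
  have \<phi>_mult: "\<phi> c (m \<otimes>\<^bsub>N\<^esub> n) = \<phi> c m \<otimes>\<^bsub>N\<^esub> \<phi> c n"
    if "c \<in> carrier C" "m \<in> carrier N" "n \<in> carrier N" for c m n
  proof -
    have "inv\<^bsub>A\<^esub> (t c) \<otimes>\<^bsub>A\<^esub> (t c \<otimes>\<^bsub>A\<^esub> x) = x" if "x \<in> carrier A" for x
      using that \<open>c \<in> carrier C\<close> by (simp flip: A.m_assoc)
    then show ?thesis
      using that N.m_closed[OF that(2,3)] by (simp add: \<phi>_def NA ker A.m_assoc)
  qed
  have bij: "bij_betw (\<phi> c) (carrier N) (carrier N)" if "c \<in> carrier C" for c
    using that
    by (intro bij_betwI[where g = "\<phi> (inv\<^bsub>C\<^esub> c)"])
      (auto simp: cl \<phi>_one simp flip: \<phi>_comp)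
  have aut: "\<phi> c \<in> auto N" if "c \<in> carrier C" for c
    using that bij[OF that] by (auto simp: auto_def Bij_def hom_def cl \<phi>_mult) (simp add: \<phi>_def)
  then have Bij: "\<phi> c \<in> Bij (carrier N)" if "c \<in> carrier C" for c
    using that by (auto simp: auto_def)
  have "\<phi> (c \<otimes>\<^bsub>C\<^esub> d) = compose (carrier N) (\<phi> c) (\<phi> d)"
    if "c \<in> carrier C" "d \<in> carrier C" for c d
    using \<phi>_comp[OF that] by (auto simp: compose_def fun_eq_iff) (simp add: \<phi>_def)
  then have \<phi>: "\<phi> \<in> hom C (AutoGroup N)"
    by (auto simp: hom_def AutoGroup_def BijGroup_def aut Bij)
  define F where "F = (\<lambda>(c, n). n \<otimes>\<^bsub>A\<^esub> t c)"
  have "F \<in> hom (semidirect_product C N \<phi>) A"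
  proof (rule homI)
    fix x y
    assume "x \<in> carrier (semidirect_product C N \<phi>)" "y \<in> carrier (semidirect_product C N \<phi>)"
    then obtain c m d n where xy: "x = (c, m)" "y = (d, n)" "c \<in> carrier C" "m \<in> carrier N"
      "d \<in> carrier C" "n \<in> carrier N"
      by (auto simp: semidirect_product_def)
    then show "F x \<in> carrier A"
      by (simp add: F_def ker)
    have "inv\<^bsub>A\<^esub> (t c) \<otimes>\<^bsub>A\<^esub> (t c \<otimes>\<^bsub>A\<^esub> t d) = t d"
      using xy by (simp flip: A.m_assoc)
    then show "F (x \<otimes>\<^bsub>semidirect_product C N \<phi>\<^esub> y) = F x \<otimes>\<^bsub>A\<^esub> F y"
      using xy by (simp add: F_def semidirect_product_def NA \<phi>_def ker A.m_assoc)
  qed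
  moreover have "bij_betw F (carrier (semidirect_product C N \<phi>)) (carrier A)"
  proof (rule bij_betwI[where g = "\<lambda>a. (\<pi> a, a \<otimes>\<^bsub>A\<^esub> inv\<^bsub>A\<^esub> (t (\<pi> a)))"])
    show "F \<in> carrier (semidirect_product C N \<phi>) \<rightarrow> carrier A"
      by (auto simp: F_def semidirect_product_def ker)
    show "(\<lambda>a. (\<pi> a, a \<otimes>\<^bsub>A\<^esub> inv\<^bsub>A\<^esub> (t (\<pi> a)))) \<in> carrier A \<rightarrow> carrier (semidirect_product C N \<phi>)"
      by (auto simp: semidirect_product_def ker split)
  qed (auto simp: F_def semidirect_product_def ker split A.m_assoc)
  ultimately have "semidirect_product C N \<phi> \<cong> A"
    by (auto simp: is_iso_def iso_def)
  then show ?thesis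
    using \<phi> group.iso_sym[OF group_semidirect_product[OF assms(2) N \<phi>]] by blast
qed

section \<open>Coordinates on a split abelian extension\<close>

locale split_abelian_extension =
  fixes G :: "('k::field_char_0, 'g::ab_group_add) avg_lie"
    and sh :: "'k \<Rightarrow> 'h::ab_group_add \<Rightarrow> 'h"
    and \<psi> :: "'g \<Rightarrow> 'h \<Rightarrow> 'h"
    and Q :: "'h \<Rightarrow> 'h"
    and E :: "('k, 'e::ab_group_add) avg_lie"
    and i :: "'h \<Rightarrow> 'e"
    and p :: "'e \<Rightarrow> 'g"
    and s :: "'g \<Rightarrow> 'e"
  assumes extension: "abelian_extension G sh \<psi> Q E i p"
    and s_hom: "s \<in> avg_lie_hom G E"
    and p_s_id: "p \<circ> s = id"
begin

abbreviation H where "H \<equiv> abelian_avg_lie sh Q"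

lemma exact: "short_exact H E G i p"
  using extension by (simp add: abelian_extension_def)

lemma algebras: "averaging_lie_algebra H" "averaging_lie_algebra E" "averaging_lie_algebra G"
  and i_hom: "i \<in> avg_lie_hom H E" and p_hom: "p \<in> avg_lie_hom E G"
  and inj_i: "inj i" and range_i: "range i = {e. p e = 0}"
  using exact by (auto simp: short_exact_def)

lemma linear_i: "Vector_Spaces.linear sh (scal E) i"
  and linear_p: "Vector_Spaces.linear (scal E) (scal G) p"
  and linear_s: "Vector_Spaces.linear (scal G) (scal E) s"
  using i_hom p_hom s_hom by (auto simp: avg_lie_hom_def abelian_avg_lie_def)

lemma p_s: "p (s x) = x" and p_i: "p (i h) = 0"
  using p_s_id range_i by (auto simp: fun_eq_iff)

lemma i_eq_iff: "i h = i k \<longleftrightarrow> h = k"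
  using inj_i by (auto dest: injD)

lemma bracket_ideal: "brack E (i h) (i k) = 0"
  using i_hom linear_facts(3)[OF linear_i] by (simp add: avg_lie_hom_def abelian_avg_lie_def)

lemma linear_section_s: "linear_section E G p s"
  using linear_s p_s_id by (simp add: linear_section_def)

lemma bracket_add:
  "brack E (u + v) w = brack E u w + brack E v w"
  "brack E w (u + v) = brack E w u + brack E w v"
  using algebras(2)
  by (auto simp: averaging_lie_algebra_def lie_bracket_def
      intro: linear_facts(1) linear_facts(1)[where f = "\<lambda>x. brack E x w"])

lemma bracket_skew: "brack E u v = - brack E v u"
proof -
  have alt: "brack E x x = 0" for x
    using algebras(2) by (simp add: averaging_lie_algebra_def lie_bracket_def)
  \<comment> \<open>polarization of the alternating law\<close>
  have "brack E (u + v) (u + v) = brack E u v + brack E v u"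
    by (simp add: bracket_add alt[of u] alt[of v] add.commute)
  then show ?thesis
    by (metis alt eq_neg_iff_add_eq_0)
qed

text \<open>
  The linear projection onto \<open>\<hh>\<close> along the subalgebra \<open>s(\<gg>)\<close>: together, \<open>q e\<close> and \<open>p e\<close> are
  the coordinates of \<open>e\<close>.
\<close>

definition q :: "'e \<Rightarrow> 'h"
  where "q e = inv_into UNIV i (e - s (p e))"

lemma decomp: "e = i (q e) + s (p e)"
proof -
  have "e - s (p e) \<in> range i"
    by (simp add: range_i linear_facts(2)[OF linear_p] p_s)
  then show ?thesis
    by (simp add: q_def f_inv_into_f)
qed

lemma p_coord: "p (i h + s x) = x"
  by (simp add: linear_facts(1)[OF linear_p] p_i p_s)

lemma q_coord: "q (i h + s x) = h"
  by (simp add: q_def p_coord inj_i)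

lemma linear_q: "Vector_Spaces.linear (scal E) sh q"
proof -
  have v: "vector_space (scal E)" "vector_space sh"
    using algebras by (auto simp: averaging_lie_algebra_def abelian_avg_lie_def)
  \<comment> \<open>The coordinates of a sum and of a multiple are read off from a decomposition of it.\<close>
  have 1: "u + v = i (q u + q v) + s (p u + p v)" for u v
    using decomp[of u] decomp[of v] linear_facts(1)[OF linear_i] linear_facts(1)[OF linear_s]
    by (metis add.assoc add.left_commute)
  have 2: "scal E r u = i (sh r (q u)) + s (scal G r (p u))" for r u
    using decomp[of u] linear_facts(4)[OF linear_i] linear_facts(4)[OF linear_s]
      vector_space.vector_space_assms(1)[OF v(1)]
    by metis
  show ?thesis
    unfolding Vector_Spaces.linear_iff
    using v 1 2 q_coord by metis
qed

text \<open>
  The bracket with an element of the kernel depends only on the class of the other argument in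
  the quotient, since the kernel is abelian.
\<close>

lemma bracket_kernel: "brack E e (i h) = i (\<psi> (p e) h)"
proof -
  have "brack E e (i h) = brack E (i (q e) + s (p e)) (i h)"
    using decomp[of e] by simp
  also have "\<dots> = i (\<psi> (p e) h)"
    by (simp only: bracket_add bracket_ideal add_0
        abelian_extension_section[OF extension linear_section_s])
  finally show ?thesis .
qed

lemma bracket_coord:
  "brack E e f = i (\<psi> (p e) (q f) - \<psi> (p f) (q e)) + s (brack G (p e) (p f))"
proof -
  have s: "brack E (s x) (s y) = s (brack G x y)" for x y
    using s_hom by (simp add: avg_lie_hom_def)
  have "brack E e f = brack E e (i (q f)) + brack E e (s (p f))"
    by (metis bracket_add(2) decomp)
  also have "brack E e (s (p f)) = brack E (i (q e)) (s (p f)) + brack E (s (p e)) (s (p f))"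
    by (metis bracket_add(1) decomp)
  finally show ?thesis
    by (simp add: bracket_kernel bracket_skew[of "i (q e)"] s p_s linear_facts(2)[OF linear_i])
qed

lemma avg_coord: "avg E e = i (Q (q e)) + s (avg G (p e))"
proof -
  have U: "Vector_Spaces.linear (scal E) (scal E) (avg E)"
    using algebras(2) by (simp add: averaging_lie_algebra_def averaging_operator_def)
  have "avg E e = avg E (i (q e)) + avg E (s (p e))"
    by (metis linear_facts(1)[OF U] decomp)
  then show ?thesis
    using i_hom s_hom by (simp add: avg_lie_hom_def abelian_avg_lie_def fun_eq_iff)
qed

section \<open>The restriction map to the compatible pairs\<close>

lemma Aut_stab_mult: "x \<otimes>\<^bsub>Aut_stab E i\<^esub> y = x \<circ> y" "\<one>\<^bsub>Aut_stab E i\<^esub> = id"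
  by (simp_all add: Aut_stab_def Aut_def)

lemma C_group_mult:
  "c \<otimes>\<^bsub>C_group G sh \<psi> Q\<^esub> d = (fst c \<circ> fst d, snd c \<circ> snd d)" "\<one>\<^bsub>C_group G sh \<psi> Q\<^esub> = (id, id)"
  by (simp_all add: C_group_def Aut_def DirProd_def split_def)

lemma C_group_iff:
  "(\<beta>, \<alpha>) \<in> carrier (C_group G sh \<psi> Q) \<longleftrightarrow>
    Vector_Spaces.linear sh sh \<beta> \<and> bij \<beta> \<and> (\<forall>h. Q (\<beta> h) = \<beta> (Q h)) \<and>
    \<alpha> \<in> avg_lie_hom G G \<and> bij \<alpha> \<and> (\<forall>x h. \<beta> (\<psi> x h) = \<psi> (\<alpha> x) (\<beta> h))"
  by (auto simp: C_group_def DirProd_def Aut_def avg_lie_hom_def abelian_avg_lie_def fun_eq_iff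
      linear_facts(3))

interpretation S: group "Aut_stab E i"
  by (rule group_Aut_stab[OF algebras(2)])

lemma Pi_map_id: "Pi_map E G i p id = (id, id)"
  using Pi_map_section(1)[OF exact S.one_closed linear_section_s] inj_i p_s_id
  by (simp add: Aut_stab_mult)

text \<open>
  That the two components are invertible follows from functoriality of \<open>\<Pi>\<close>, applied to \<open>\<gamma>\<close> and
  its inverse.
\<close>

lemma bij_Pi_map:
  assumes "\<gamma> \<in> carrier (Aut_stab E i)"
  shows "bij (fst (Pi_map E G i p \<gamma>))" "bij (snd (Pi_map E G i p \<gamma>))"
proof -
  let ?d = "inv\<^bsub>Aut_stab E i\<^esub> \<gamma>"
  have "\<gamma> \<circ> ?d = id" "?d \<circ> \<gamma> = id"
    using S.r_inv[OF assms] S.l_inv[OF assms] by (simp_all add: Aut_stab_mult)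
  then have
    "fst (Pi_map E G i p \<gamma>) \<circ> fst (Pi_map E G i p ?d) = id \<and>
     snd (Pi_map E G i p \<gamma>) \<circ> snd (Pi_map E G i p ?d) = id"
    "fst (Pi_map E G i p ?d) \<circ> fst (Pi_map E G i p \<gamma>) = id \<and>
     snd (Pi_map E G i p ?d) \<circ> snd (Pi_map E G i p \<gamma>) = id"
    using Pi_map_comp[OF exact assms S.inv_closed[OF assms]]
      Pi_map_comp[OF exact S.inv_closed[OF assms] assms] Pi_map_id by simp_all
  then show "bij (fst (Pi_map E G i p \<gamma>))" "bij (snd (Pi_map E G i p \<gamma>))"
    by (auto intro: o_bij)
qed

lemma avg_lie_hom_comp:
  "f \<in> avg_lie_hom A B \<Longrightarrow> g \<in> avg_lie_hom B C \<Longrightarrow> g \<circ> f \<in> avg_lie_hom A C"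
  by (auto simp: avg_lie_hom_def fun_eq_iff intro: Vector_Spaces.linear_compose)

text \<open>
  The compatibility of the components \<open>\<beta>\<close> and \<open>\<alpha>\<close> is the image of \<open>[s x, i h] = i (\<psi>\<^sub>x h)\<close> under
  \<open>\<gamma>\<close>: its left-hand side becomes \<open>[\<gamma> (s x), i (\<beta> h)]\<close>, and \<open>\<gamma> (s x)\<close> lies over \<open>\<alpha> x\<close>.
  The identities for \<open>\<beta>\<close> can all be checked after applying the injective \<open>i\<close>, where \<open>i \<circ> \<beta>\<close>
  becomes \<open>\<gamma> \<circ> i\<close>; and \<open>\<alpha>\<close> is a composition of morphisms, since the section is one.
\<close>

lemma Pi_map_in_C_group:
  assumes \<gamma>: "\<gamma> \<in> carrier (Aut_stab E i)"
  shows "Pi_map E G i p \<gamma> \<in> carrier (C_group G sh \<psi> Q)"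
proof -
  define \<beta> where "\<beta> = inv_into UNIV i \<circ> \<gamma> \<circ> i"
  let ?\<alpha> = "p \<circ> \<gamma> \<circ> s"
  note Pi = Pi_map_section[OF exact \<gamma> linear_section_s]
  have \<gamma>_hom: "\<gamma> \<in> avg_lie_hom E E"
    using \<gamma> by (simp add: Aut_stab_def Aut_def)
  have i\<beta>: "i (\<beta> h) = \<gamma> (i h)" for h
    using Pi(2) by (simp add: fun_eq_iff \<beta>_def)
  have "\<gamma> \<circ> i \<in> avg_lie_hom H E"
    using i_hom \<gamma>_hom by (rule avg_lie_hom_comp)
  then have \<gamma>i: "Vector_Spaces.linear sh (scal E) (\<gamma> \<circ> i)" "\<And>h. avg E (\<gamma> (i h)) = \<gamma> (i (Q h))"
    by (auto simp: avg_lie_hom_def abelian_avg_lie_def fun_eq_iff)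
  have v: "vector_space sh"
    using algebras(1) by (simp add: averaging_lie_algebra_def abelian_avg_lie_def)
  have "i (\<beta> (h + k)) = i (\<beta> h + \<beta> k)" "i (\<beta> (sh r h)) = i (sh r (\<beta> h))" for h k r
    using linear_facts(1,4)[OF \<gamma>i(1)]
    by (simp_all add: i\<beta> linear_facts(1)[OF linear_i, of "\<beta> h"]
        linear_facts(4)[OF linear_i, of r "\<beta> h"])
  then have "Vector_Spaces.linear sh sh \<beta>"
    unfolding Vector_Spaces.linear_iff i_eq_iff using v by blast
  moreover have "i (Q (\<beta> h)) = i (\<beta> (Q h))" for h
  proof -
    have "i (Q (\<beta> h)) = avg E (i (\<beta> h))"
      using i_hom by (simp add: avg_lie_hom_def abelian_avg_lie_def fun_eq_iff)
    then show ?thesis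
      by (simp only: i\<beta> \<gamma>i)
  qed
  then have "\<forall>h. Q (\<beta> h) = \<beta> (Q h)"
    unfolding i_eq_iff by blast
  moreover have "?\<alpha> \<in> avg_lie_hom G G"
    by (intro avg_lie_hom_comp[OF s_hom] avg_lie_hom_comp[OF \<gamma>_hom] p_hom)
  moreover have "i (\<beta> (\<psi> x h)) = i (\<psi> (?\<alpha> x) (\<beta> h))" for x h
  proof -
    have "i (\<beta> (\<psi> x h)) = \<gamma> (brack E (s x) (i h))"
      by (simp only: i\<beta> bracket_kernel p_s)
    also have "\<dots> = brack E (\<gamma> (s x)) (\<gamma> (i h))"
      using \<gamma>_hom by (simp add: avg_lie_hom_def)
    also have "\<dots> = i (\<psi> (?\<alpha> x) (\<beta> h))"
      by (simp only: i\<beta>[symmetric] bracket_kernel o_apply)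
    finally show ?thesis .
  qed
  then have "\<forall>x h. \<beta> (\<psi> x h) = \<psi> (?\<alpha> x) (\<beta> h)"
    unfolding i_eq_iff by blast
  ultimately show ?thesis
    using bij_Pi_map[OF \<gamma>] unfolding Pi(1) \<beta>_def[symmetric] C_group_iff fst_conv snd_conv by blast
qed

section \<open>Lifting compatible pairs\<close>

definition lift :: "('h \<Rightarrow> 'h) \<times> ('g \<Rightarrow> 'g) \<Rightarrow> 'e \<Rightarrow> 'e"
  where "lift c e = i (fst c (q e)) + s (snd c (p e))"

lemma lift_comp: "lift c \<circ> lift d = lift (fst c \<circ> fst d, snd c \<circ> snd d)"
  by (simp add: lift_def fun_eq_iff p_coord q_coord)

lemma lift_id: "lift (id, id) = id"
  by (simp add: lift_def fun_eq_iff flip: decomp)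

lemma lift_i: "\<alpha> 0 = 0 \<Longrightarrow> lift (\<beta>, \<alpha>) (i h) = i (\<beta> h)"
  using q_coord[of h 0] by (simp add: lift_def p_i linear_facts(3)[OF linear_s])

lemma p_lift: "p (lift (\<beta>, \<alpha>) e) = \<alpha> (p e)"
  by (simp add: lift_def p_coord)

text \<open>
  The bracket in coordinates is built from \<open>\<psi>\<close> and the bracket of \<open>G\<close>. The map \<open>\<alpha>\<close> preserves
  the latter, and the compatibility of \<open>\<beta>\<close> with \<open>\<alpha>\<close> is what makes the lift respect the
  terms with \<open>\<psi>\<close>. The inverse of the lift is the lift of the componentwise inverses.
\<close>

lemma lift_in_Aut_stab:
  assumes "c \<in> carrier (C_group G sh \<psi> Q)"
  shows "lift c \<in> carrier (Aut_stab E i)"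
proof -
  obtain \<beta> \<alpha> where c: "c = (\<beta>, \<alpha>)" by force
  have \<beta>: "Vector_Spaces.linear sh sh \<beta>" "bij \<beta>" "\<And>h. Q (\<beta> h) = \<beta> (Q h)"
    and \<alpha>: "\<alpha> \<in> avg_lie_hom G G" "bij \<alpha>"
    and compat: "\<And>x h. \<beta> (\<psi> x h) = \<psi> (\<alpha> x) (\<beta> h)"
    using assms unfolding c C_group_iff by auto
  have \<alpha>': "Vector_Spaces.linear (scal G) (scal G) \<alpha>"
    "\<And>x y. \<alpha> (brack G x y) = brack G (\<alpha> x) (\<alpha> y)" "\<And>x. avg G (\<alpha> x) = \<alpha> (avg G x)"
    using \<alpha>(1) by (auto simp: avg_lie_hom_def fun_eq_iff)
  have v: "vector_space (scal E)" "vector_space sh"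
    using algebras by (auto simp: averaging_lie_algebra_def abelian_avg_lie_def)
  interpret vector_space_pair "scal E" "scal E"
    using v by (simp add: vector_space_pair_def)
  have "Vector_Spaces.linear (scal E) (scal E) (\<lambda>e. (i \<circ> (\<beta> \<circ> q)) e + (s \<circ> (\<alpha> \<circ> p)) e)"
    by (intro linear_compose_add Vector_Spaces.linear_compose[OF _ linear_i]
        Vector_Spaces.linear_compose[OF _ linear_s] Vector_Spaces.linear_compose[OF linear_q \<beta>(1)]
        Vector_Spaces.linear_compose[OF linear_p \<alpha>'(1)])
  then have "Vector_Spaces.linear (scal E) (scal E) (lift c)"
    by (simp add: lift_def[abs_def] c o_def)
  moreover have "lift c (brack E e f) = brack E (lift c e) (lift c f)" for e f
    by (simp add: c lift_def bracket_coord p_coord q_coord linear_facts(2)[OF \<beta>(1)] compat \<alpha>'(2))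
  moreover have "avg E (lift c e) = lift c (avg E e)" for e
    by (simp add: c lift_def avg_coord p_coord q_coord \<beta>(3) \<alpha>'(3))
  ultimately have "lift c \<in> avg_lie_hom E E"
    by (simp add: avg_lie_hom_def fun_eq_iff)
  moreover have "bij (lift c)"
  proof (rule o_bij)
    let ?c' = "(inv_into UNIV \<beta>, inv_into UNIV \<alpha>)"
    show "lift ?c' \<circ> lift c = id" "lift c \<circ> lift ?c' = id"
      using \<beta>(2) \<alpha>(2) lift_id
      by (simp_all add: lift_comp c bij_is_inj surj_iff[THEN iffD1] bij_is_surj)
  qed
  moreover have "lift c ` range i = range i"
  proof -
    have "lift c ` range i = i ` range \<beta>"
      by (simp add: c image_image lift_i linear_facts(3)[OF \<alpha>'(1)])
    then show ?thesis
      using \<beta>(2) by (simp add: bij_is_surj)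
  qed
  ultimately show ?thesis
    by (simp add: Aut_stab_def Aut_def)
qed

lemma Pi_map_lift:
  assumes "c \<in> carrier (C_group G sh \<psi> Q)"
  shows "Pi_map E G i p (lift c) = c"
proof -
  obtain \<beta> \<alpha> where c: "c = (\<beta>, \<alpha>)" by force
  have "\<alpha> 0 = 0"
    using assms linear_facts(3) unfolding c C_group_iff avg_lie_hom_def by blast
  then show ?thesis
    unfolding Pi_map_section(1)[OF exact lift_in_Aut_stab[OF assms] linear_section_s]
    by (simp add: c fun_eq_iff lift_i p_lift p_s inj_i)
qed

theorem Aut_stab_semidirect_product:
  "\<exists>\<phi> \<in> hom (C_group G sh \<psi> Q) (AutoGroup (Aut_stab_id E G i p)).
    Aut_stab E i \<cong> semidirect_product (C_group G sh \<psi> Q) (Aut_stab_id E G i p) \<phi>"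
proof -
  have C: "group (C_group G sh \<psi> Q)"
    using group.subgroup_imp_group[OF DirProd_group[OF group_Aut group_Aut] subgroup_C_group]
      algebras by (simp add: C_group_def)
  have "Pi_map E G i p \<in> hom (Aut_stab E i) (C_group G sh \<psi> Q)"
    by (rule homI) (simp_all add: Pi_map_in_C_group Pi_map_comp[OF exact] Aut_stab_mult C_group_mult)
  moreover have "lift \<in> hom (C_group G sh \<psi> Q) (Aut_stab E i)"
    by (rule homI) (simp_all add: lift_in_Aut_stab lift_comp Aut_stab_mult C_group_mult)
  moreover have "Aut_stab_id E G i p =
      (Aut_stab E i)\<lparr>carrier := kernel (Aut_stab E i) (C_group G sh \<psi> Q) (Pi_map E G i p)\<rparr>"
    by (simp add: Aut_stab_id_def kernel_def C_group_mult)
  ultimately show ?thesis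
    using split_epi_semidirect_product[OF S.is_group C] Pi_map_lift by simp
qed

end

section \<open>The semidirect product decomposition\<close>

theorem proposition6p4:
  fixes G :: "('k::field_char_0, 'g::ab_group_add) avg_lie"
    and sh :: "'k \<Rightarrow> 'h::ab_group_add \<Rightarrow> 'h"
    and \<psi> :: "'g \<Rightarrow> 'h \<Rightarrow> 'h"
    and Q :: "'h \<Rightarrow> 'h"
    and E :: "('k, 'e::ab_group_add) avg_lie"
    and i :: "'h \<Rightarrow> 'e"
    and p :: "'e \<Rightarrow> 'g"
  assumes "averaging_lie_algebra G"
    and "averaging_representation G sh \<psi> Q"
    and "abelian_extension G sh \<psi> Q E i p"
    and "split_extension E G p"
  shows "\<exists>\<phi> \<in> hom (C_group G sh \<psi> Q) (AutoGroup (Aut_stab_id E G i p)).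
    Aut_stab E i \<cong> semidirect_product (C_group G sh \<psi> Q) (Aut_stab_id E G i p) \<phi>"
proof -
  obtain s where "s \<in> avg_lie_hom G E" "p \<circ> s = id"
    using assms(4) by (auto simp: split_extension_def)
  then interpret split_abelian_extension G sh \<psi> Q E i p s
    using assms(3) by unfold_locales
  show ?thesis
    by (rule Aut_stab_semidirect_product)
qed

end
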